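(* Suppose that $F: X \to Y$ is closed and $x^\dagger \in E_\gamma$. For $n\in\mathbb{N}$ let $y_n = F(x^\dagger)+\delta_n\eta_n$, where $\eta_n\sim\mathcal{N}(0,\Sigma)$ are independently and identically distributed, and let $x_n\in E_\gamma$ denote a minimizer of $$I_n(x) := \frac{1}{2\delta_n^2} \big\| \Sigma^{-\frac12}(F(x) - y_n) \big\|_Y^2 + \iota_{E_\gamma}(x),\qquad x\in X.$$ Then any such sequence $\{x_n\}_{n\in\mathbb{N}}$ of minimizers contains a convergent subsequence whose limit $\bar{x} \in E_\gamma$ satisfies $F(\bar{x}) = F(x^\dagger)$ almost surely.
   Context: $X := \{x=\{x_k\}_{k\in\mathbb{N}} \in \ell^\infty: \lim_{k\to\infty} x_k = 0\}$ (i.e. $X=c_0$), endowed with the norm $\|x\|_\infty=\sup_{k}|x_k|$. $\{\gamma_k\}_{k\in\mathbb{N}}$ is a sequence of non-negative reals with $\gamma_k\to0$, $E_\gamma := \{x \in X : |x_k| \le \gamma_k \text{ for all } k \in \mathbb{N}\}$, and $\iota_{E_\gamma}(x)=0$ if $x\in E_\gamma$ and $\iota_{E_\gamma}(x)=\infty$ otherwise. $Y=\mathbb{R}^K$ for a fixed $K\in\mathbb{N}$, endowed with the Euclidean norm; $F:X\to Y$ is a (nonlinear) operator; $\Sigma\in\mathbb{R}^{K\times K}$ is a positive definite covariance operator; $\{\delta_n\}_{n\in\mathbb{N}}\subset(0,\infty)$ with $\delta_n\to0$. An operator $F:X\to Y$ is closed if its graph is closed, i.e. $u_n\to u$ in $X$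 and $F(u_n)\to z$ in $Y$ imply $F(u)=z$. The $x_n$ are random, since they depend on the noise through $y_n$. *)

theory Defs
  imports "HOL-Probability.Probability"
begin

text \<open>
  With the discrete topology on the natural numbers, \<^typ>\<open>nat \<Rightarrow>\<^sub>C real\<close> is the space of bounded
  real sequences, and its library norm is the supremum norm. So the following is the
  space of null sequences, regarded as a subspace of the bounded sequences.
\<close>

definition c0 :: "(nat \<Rightarrow>\<^sub>C real) set" where
  "c0 = {x. apply_bcontfun x \<longlonglongrightarrow> 0}"

definition E_set :: "(nat \<Rightarrow> real) \<Rightarrow> (nat \<Rightarrow>\<^sub>C real) set" where
  "E_set \<gamma> = {x \<in> c0. \<forall>k. \<bar>apply_bcontfun x k\<bar> \<le> \<gamma> k}"

text \<open>Closedness of an operator with domain \<open>X\<close>; values of \<open>F\<close> outside \<open>X\<close> are irrelevant.\<close>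

definition closed_operator_on ::
    "'a::metric_space set \<Rightarrow> ('a \<Rightarrow> 'b::metric_space) \<Rightarrow> bool" where
  "closed_operator_on X F \<longleftrightarrow>
     (\<forall>u u0 z. (\<forall>n. u n \<in> X) \<and> u0 \<in> X \<and> u \<longlonglongrightarrow> u0 \<and> (\<lambda>n. F (u n)) \<longlonglongrightarrow> z \<longrightarrow> F u0 = z)"

definition positive_definite :: "real^'k^'k \<Rightarrow> bool" where
  "positive_definite A \<longleftrightarrow> transpose A = A \<and> (\<forall>v. v \<noteq> 0 \<longrightarrow> v \<bullet> (A *v v) > 0)"

text \<open>The square root is meaningful for positive definite \<open>A\<close> only.\<close>

definition matrix_sqrt :: "real^'k^'k \<Rightarrow> real^'k^'k" where
  "matrix_sqrt A = (THE R. positive_definite R \<and> R ** R = A)"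

definition matrix_inv_sqrt :: "real^'k^'k \<Rightarrow> real^'k^'k" where
  "matrix_inv_sqrt A = matrix_inv (matrix_sqrt A)"

text \<open>Lebesgue density of the normal distribution with mean \<open>m\<close> and positive definite covariance \<open>S\<close>.\<close>

definition mvnormal_density :: "real^'k \<Rightarrow> real^'k^'k \<Rightarrow> real^'k \<Rightarrow> real" where
  "mvnormal_density m S v =
     exp (- ((v - m) \<bullet> (matrix_inv S *v (v - m))) / 2) / sqrt ((2 * pi) ^ CARD('k) * det S)"

text \<open>The indicator function of convex analysis (not the 0-1 indicator of the library).\<close>

definition iota :: "'a set \<Rightarrow> 'a \<Rightarrow> ereal" where
  "iota E x = (if x \<in> E then 0 else \<infinity>)"

definition tikhonov_functional ::
    "((nat \<Rightarrow>\<^sub>C real) \<Rightarrow> real^'k) \<Rightarrow> (nat \<Rightarrow> real) \<Rightarrow> real^'k^'k \<Rightarrow> real \<Rightarrow> real^'k \<Rightarrow>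
     (nat \<Rightarrow>\<^sub>C real) \<Rightarrow> ereal" where
  "tikhonov_functional F \<gamma> S \<delta> y x =
     ereal (1 / (2 * \<delta>\<^sup>2) * (norm (matrix_inv_sqrt S *v (F x - y)))\<^sup>2) + iota (E_set \<gamma>) x"

end

theory Submission
  imports Defs
begin

text \<open>
  Comparing \<open>x n\<close> with the competitor \<open>xd\<close>, whose residual \<open>y n - F xd\<close> is the noise
  \<open>\<delta> n *\<^sub>R \<eta> n\<close>, the triangle inequality bounds the whitened difference
  \<open>F (x n) - F xd\<close> by twice the norm of the whitened noise. The variables \<open>\<eta> n\<close>
  share one law, so this noise tends to \<open>0\<close> in probability,
  and along a subsequence that does not depend on the sample it tends to \<open>0\<close> almost surely
  (\<open>identically_distributed_scaled_AE_subseq\<close>). For each such sample, a further subsequence of \<open>x n\<close>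
  converges because \<open>E_set \<gamma>\<close> is sequentially compact in the supremum norm: coordinatewise
  compactness is Tychonov's theorem, and the common majorant \<open>\<gamma>\<close>, being a null sequence, makes
  coordinatewise convergence uniform (\<open>seq_compact_E_set\<close>). The values of \<open>F\<close> along this
  subsequence tend to \<open>F xd\<close>, and closedness of \<open>F\<close> identifies \<open>F xd\<close> with the value at the limit.

  The difference itself, and not only its whitened form, tends to \<open>0\<close> because the whitening matrix
  is invertible. As \<open>matrix_sqrt\<close> is a definite description, this rests on the existence and
  uniqueness of the positive definite square root, which is obtained from the spectral theorem for
  self-adjoint maps (\<open>selfadjoint_orthonormal_eigenbasis\<close>).
\<close>

section \<open>Self-adjoint maps and the positive definite square root\<close>

text \<open>
  An eigenvector is a maximizer \<open>v\<close> of the quadratic form of \<open>f\<close> on the unit sphere of \<open>V\<close>: with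
  \<open>c\<close> the maximum, the form \<open>c * (u \<bullet> u) - u \<bullet> f u\<close> is nonnegative on \<open>V\<close> and vanishes at \<open>v\<close>, so its
  derivative at \<open>v\<close> in the direction of the defect \<open>c *\<^sub>R v - f v\<close> must vanish, and that
  derivative is twice the squared norm of the defect.
\<close>

lemma selfadjoint_has_eigenvector:
  fixes f :: "'a::euclidean_space \<Rightarrow> 'a"
  assumes lin: "linear f" and sa: "\<And>x y. f x \<bullet> y = x \<bullet> f y"
    and V: "subspace V" "f ` V \<subseteq> V" "V \<noteq> {0}"
  obtains v c where "v \<in> V" "norm v = 1" "f v = c *\<^sub>R v"
proof -
  interpret f: linear f by (rule lin)
  obtain z where z: "z \<in> V" "z \<noteq> 0"
    using V(1,3) subspace_0 by blast
  let ?K = "V \<inter> sphere 0 1"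
  have ne: "?K \<noteq> {}"
    using z subspace_scale[OF V(1) z(1), of "1 / norm z"] by auto
  have "compact ?K"
    by (rule closed_Int_compact[OF closed_subspace[OF V(1)] compact_sphere])
  moreover have "continuous_on ?K (\<lambda>u. u \<bullet> f u)"
    by (intro continuous_on_inner continuous_on_id linear_continuous_on)
       (simp add: linear_conv_bounded_linear[symmetric] lin)
  ultimately obtain v where v: "v \<in> ?K" and max: "\<And>u. u \<in> ?K \<Longrightarrow> u \<bullet> f u \<le> v \<bullet> f v"
    using continuous_attains_sup[of ?K "\<lambda>u. u \<bullet> f u"] ne by blast
  define c where "c = v \<bullet> f v"
  define g where "g u = c * (u \<bullet> u) - u \<bullet> f u" for u
  have g_nonneg: "0 \<le> g u" if "u \<in> V" for u
  proof (cases "u = 0")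
    case False
    let ?e = "(1 / norm u) *\<^sub>R u"
    have "?e \<in> ?K"
      using that False V(1) by (auto simp: subspace_scale)
    from max[OF this] have "(u \<bullet> f u) / (norm u * norm u) \<le> c"
      by (simp add: c_def f.scaleR)
    then show ?thesis
      using False by (simp add: g_def field_simps dot_square_norm power2_eq_square)
  qed (simp add: g_def f.zero)
  have v1: "v \<in> V" "norm v = 1" using v by auto
  define w where "w = c *\<^sub>R v - f v"
  have w: "w \<in> V"
    using v1 V by (auto simp: w_def intro!: subspace_diff subspace_scale)
  have "v \<bullet> v = 1" using v1 by (simp add: dot_square_norm)
  have expand: "g (v - s *\<^sub>R w) = s * (s * g w - 2 * (w \<bullet> w))" for s
  proof -
    have "v \<bullet> f w = w \<bullet> f v" using sa[of v w] by (simp add: inner_commute)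
    then show ?thesis
      using \<open>v \<bullet> v = 1\<close> unfolding g_def
      by (simp add: f.diff f.scaleR inner_diff_left inner_diff_right c_def[symmetric] inner_commute)
         (simp add: w_def inner_diff_left inner_diff_right algebra_simps inner_commute c_def)
  qed
  have "w = 0"
  proof (rule ccontr)
    assume "w \<noteq> 0"
    (* any positive step with s * g w < 2 * (w \<bullet> w) makes g negative at v - s *\<^sub>R w *)
    define s where "s = (w \<bullet> w) / (g w + 1)"
    have gw: "0 \<le> g w" by (rule g_nonneg[OF w])
    have ww: "0 < w \<bullet> w" using \<open>w \<noteq> 0\<close> by simp
    have s: "0 < s" using gw ww by (simp add: s_def)
    have "s * g w \<le> w \<bullet> w"
      using gw ww by (simp add: s_def field_simps)
    then have "s * (s * g w - 2 * (w \<bullet> w)) < 0"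
      using s ww by (intro mult_pos_neg) linarith+
    moreover have "v - s *\<^sub>R w \<in> V"
      using v1 w V(1) by (auto intro: subspace_diff subspace_scale)
    ultimately show False using g_nonneg expand by (metis not_le)
  qed
  with v1 show thesis by (intro that[of v c]) (auto simp: w_def)
qed

text \<open>
  The spectral theorem, stated for invariant subspaces so that the induction can pass to the
  orthogonal complement of an eigenvector, which self-adjointness keeps invariant.
\<close>

lemma selfadjoint_orthonormal_eigenbasis:
  fixes f :: "'a::euclidean_space \<Rightarrow> 'a"
  assumes lin: "linear f" and sa: "\<And>x y. f x \<bullet> y = x \<bullet> f y"
    and V: "subspace V" "f ` V \<subseteq> V"
  shows "\<exists>B. pairwise orthogonal B \<and> (\<forall>b\<in>B. norm b = 1 \<and> (\<exists>c. f b = c *\<^sub>R b)) \<and> span B = V"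
  using V
proof (induction "dim V" arbitrary: V rule: less_induct)
  case less
  show ?case
  proof (cases "V = {0}")
    case True
    then show ?thesis by (intro exI[of _ "{}"]) auto
  next
    case False
    obtain v c where v: "v \<in> V" "norm v = 1" "f v = c *\<^sub>R v"
      using selfadjoint_has_eigenvector[OF lin sa less.prems False] by blast
    have vv: "v \<bullet> v = 1" using v(2) by (simp add: dot_square_norm)
    let ?W = "V \<inter> {w. v \<bullet> w = 0}"
    have W: "subspace ?W"
      by (intro subspace_inter less.prems subspace_hyperplane)
    have "v \<notin> ?W" using vv by simp
    then have "?W \<subset> V" using v(1) by blast
    then have "span ?W \<subset> span V"
      using W less.prems(1) by (metis span_eq_iff)
    then have "dim ?W < dim V" by (rule dim_psubset)
    moreover have "f ` ?W \<subseteq> ?W"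
      using less.prems(2) v(3) by (auto simp: sa[symmetric])
    ultimately obtain B where B: "pairwise orthogonal B"
      "\<And>b. b \<in> B \<Longrightarrow> norm b = 1 \<and> (\<exists>c. f b = c *\<^sub>R b)" "span B = ?W"
      using less.hyps[of ?W] W by blast
    have orth: "v \<bullet> b = 0" if "b \<in> B" for b
      using span_base[OF that] B(3) by simp
    have "V \<subseteq> span (insert v B)"
    proof
      fix u assume u: "u \<in> V"
      have "u - (v \<bullet> u) *\<^sub>R v \<in> span B"
        unfolding B(3) using u v(1) less.prems(1) vv
        by (auto simp: inner_diff_right intro: subspace_diff subspace_scale)
      then show "u \<in> span (insert v B)"
        by (auto simp: span_insert)
    qed
    moreover have "span (insert v B) \<subseteq> V"
      using v(1) span_superset[of B] B(3) by (intro span_minimal less.prems(1)) auto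
    moreover have "pairwise orthogonal (insert v B)"
      using B(1) orth by (auto simp: pairwise_insert orthogonal_def inner_commute)
    ultimately show ?thesis
      using v B(2) by (intro exI[of _ "insert v B"]) auto
  qed
qed

lemma selfadjoint_eq_0_if_eigenvalues_0:
  fixes f :: "'a::euclidean_space \<Rightarrow> 'a"
  assumes lin: "linear f" and sa: "\<And>x y. f x \<bullet> y = x \<bullet> f y"
    and ev: "\<And>v c. v \<noteq> 0 \<Longrightarrow> f v = c *\<^sub>R v \<Longrightarrow> c = 0"
  shows "f x = 0"
proof -
  obtain B where B: "\<And>b. b \<in> B \<Longrightarrow> norm b = 1 \<and> (\<exists>c. f b = c *\<^sub>R b)" "span B = UNIV"
    using selfadjoint_orthonormal_eigenbasis[OF lin sa subspace_UNIV] by auto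
  have "f b = 0" if "b \<in> B" for b
    using B(1)[OF that] ev[of b] by auto
  then show ?thesis
    using linear_eq_0_on_span[OF lin, of B x] B(2) by auto
qed

text \<open>
  In an orthonormal eigenbasis the square root scales each coordinate by the root of its eigenvalue.
\<close>

lemma positive_selfadjoint_sqrt_exists:
  fixes f :: "'a::euclidean_space \<Rightarrow> 'a"
  assumes lin: "linear f" and sa: "\<And>x y. f x \<bullet> y = x \<bullet> f y"
    and pos: "\<And>x. x \<noteq> 0 \<Longrightarrow> 0 < x \<bullet> f x"
  obtains g where "linear g" "\<And>x y. g x \<bullet> y = x \<bullet> g y" "\<And>x. x \<noteq> 0 \<Longrightarrow> 0 < x \<bullet> g x"
    "\<And>x. g (g x) = f x"
proof -
  obtain B where B: "pairwise orthogonal B" "\<And>b. b \<in> B \<Longrightarrow> norm b = 1 \<and> (\<exists>c. f b = c *\<^sub>R b)"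
    "span B = UNIV"
    using selfadjoint_orthonormal_eigenbasis[OF lin sa subspace_UNIV] by auto
  obtain c where c: "\<And>b. b \<in> B \<Longrightarrow> f b = c b *\<^sub>R b" using B(2) by metis
  have fin: "finite B" by (rule pairwise_orthogonal_imp_finite[OF B(1)])
  have bb: "b \<bullet> b = 1" if "b \<in> B" for b using B(2)[OF that] by (simp add: dot_square_norm)
  have c_pos: "0 < c b" if "b \<in> B" for b
    using pos[of b] bb[OF that] c[OF that] by fastforce
  define g where "g x = (\<Sum>b\<in>B. (sqrt (c b) * (b \<bullet> x)) *\<^sub>R b)" for x
  have g_lin: "linear g"
    by (rule linearI)
       (simp_all add: g_def inner_add_right algebra_simps scaleR_add_left sum.distrib scaleR_sum_right)
  have g_B: "g b = sqrt (c b) *\<^sub>R b" if b: "b \<in> B" for b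
  proof -
    have "g b = (\<Sum>a\<in>B. if a = b then sqrt (c b) *\<^sub>R b else 0)"
      unfolding g_def using B(1) b bb
      by (intro sum.cong refl) (auto simp: pairwise_def orthogonal_def)
    then show ?thesis using fin b by simp
  qed
  have gg: "g (g x) = f x" for x
  proof -
    have "(g \<circ> g) x = f x"
    proof (rule linear_eq_on_span[where B = B and f = "g \<circ> g" and g = f])
      show "linear (g \<circ> g)" by (rule linear_compose[OF g_lin g_lin])
      show "(g \<circ> g) b = f b" if "b \<in> B" for b
        using g_B[OF that] c[OF that] c_pos[OF that] by (simp add: linear_scale[OF g_lin])
    qed (use lin B(3) in auto)
    then show ?thesis by simp
  qed
  have g_form: "x \<bullet> g y = (\<Sum>b\<in>B. sqrt (c b) * (b \<bullet> x) * (b \<bullet> y))" for x y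
    by (simp add: g_def inner_sum_right mult_ac inner_commute)
  have g_sa: "g x \<bullet> y = x \<bullet> g y" for x y
    using g_form[of y x] g_form[of x y] by (simp add: inner_commute mult_ac)
  have g_pos: "0 < x \<bullet> g x" if "x \<noteq> 0" for x
  proof -
    have nn: "0 \<le> sqrt (c b) * (b \<bullet> x) * (b \<bullet> x)" if "b \<in> B" for b
      using c_pos[OF that] by (simp add: mult.assoc)
    have "\<exists>b\<in>B. b \<bullet> x \<noteq> 0"
    proof (rule ccontr)
      assume "\<not> (\<exists>b\<in>B. b \<bullet> x \<noteq> 0)"
      then have "orthogonal x b" if "b \<in> B" for b
        using that inner_commute[of b x] by (auto simp: orthogonal_def)
      then have "orthogonal x x"
        using orthogonal_to_span[of x B x] B(3) by simp
      with \<open>x \<noteq> 0\<close> show False by (simp add: orthogonal_def)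
    qed
    then obtain b where b: "b \<in> B" "b \<bullet> x \<noteq> 0" by blast
    then have "0 < (b \<bullet> x) * (b \<bullet> x)" using not_real_square_gt_zero by blast
    then have "0 < sqrt (c b) * (b \<bullet> x) * (b \<bullet> x)"
      using c_pos[OF b(1)] by (simp add: mult.assoc)
    then show ?thesis unfolding g_form using fin b(1) nn by (intro sum_pos2[of B b]) auto
  qed
  show thesis using that[OF g_lin g_sa g_pos gg] .
qed

lemma symmetric_matrix_inner:
  fixes A :: "real^'k^'k"
  assumes "transpose A = A"
  shows "(A *v x) \<bullet> y = x \<bullet> (A *v y)"
  using dot_lmul_matrix[of x A y] transpose_matrix_vector[of A x] assms by simp

text \<open>
  Uniqueness: for two roots \<open>R\<close>, \<open>Q\<close> of the same matrix, \<open>D = R - Q\<close> satisfies \<open>R D + D Q = 0\<close>.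
  Tested with an eigenvector of the symmetric matrix \<open>D\<close>, this forces the eigenvalue to be \<open>0\<close>,
  as \<open>R + Q\<close> has a positive quadratic form. So \<open>D\<close> has no eigenvalue besides \<open>0\<close> and vanishes.
\<close>

lemma positive_definite_sqrt_unique:
  fixes R Q :: "real^'k^'k"
  assumes R: "positive_definite R" and Q: "positive_definite Q" and eq: "R ** R = Q ** Q"
  shows "R = Q"
proof -
  let ?D = "\<lambda>v. R *v v - Q *v v"
  have sym: "(R *v x) \<bullet> y = x \<bullet> (R *v y)" "(Q *v x) \<bullet> y = x \<bullet> (Q *v y)" for x y
    using R Q by (simp_all add: positive_definite_def symmetric_matrix_inner)
  have "?D x = 0" for x
  proof (rule selfadjoint_eq_0_if_eigenvalues_0[where f = ?D])
    show "linear ?D"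
      by (intro linear_compose_sub matrix_vector_mul_linear)
    show "?D x \<bullet> y = x \<bullet> ?D y" for x y
      using sym[of x y] by (simp add: inner_diff_left inner_diff_right)
    fix v :: "real^'k" and c :: real
    assume v: "v \<noteq> 0" and ev: "?D v = c *\<^sub>R v"
    have "R *v (R *v v) = Q *v (Q *v v)"
      by (simp add: matrix_vector_mul_assoc eq)
    then have "R *v ?D v + ?D (Q *v v) = 0"
      by (simp add: matrix_vector_mult_diff_distrib)
    then have "v \<bullet> (R *v ?D v) + v \<bullet> ?D (Q *v v) = 0"
      by (metis inner_add_right inner_zero_right)
    moreover have "v \<bullet> ?D (Q *v v) = ?D v \<bullet> (Q *v v)"
      by (simp add: inner_diff_left inner_diff_right sym)
    moreover have "R *v ?D v = c *\<^sub>R (R *v v)" unfolding ev by (simp add: matrix_vector_mult_scaleR)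
    ultimately have "c * (v \<bullet> (R *v v) + v \<bullet> (Q *v v)) = 0"
      unfolding ev by (simp add: algebra_simps)
    moreover have "0 < v \<bullet> (R *v v) + v \<bullet> (Q *v v)"
      using R Q v by (simp add: positive_definite_def add_pos_pos)
    ultimately show "c = 0" by simp
  qed
  then show ?thesis by (simp add: matrix_eq)
qed

text \<open>
  Existence and uniqueness together show that the description defining \<open>matrix_sqrt\<close> denotes.
\<close>

lemma positive_definite_matrix_sqrt:
  fixes S :: "real^'k^'k"
  assumes S: "positive_definite S"
  shows "positive_definite (matrix_sqrt S)"
proof -
  have "\<exists>R. positive_definite R \<and> R ** R = S"
  proof -
    obtain g where g: "linear g" "\<And>x y. g x \<bullet> y = x \<bullet> g y" "\<And>x. x \<noteq> 0 \<Longrightarrow> 0 < x \<bullet> g x"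
      "\<And>x. g (g x) = S *v x"
      using positive_selfadjoint_sqrt_exists[of "(*v) S"] S
      by (auto simp: positive_definite_def symmetric_matrix_inner matrix_vector_mul_linear)
    have mg: "matrix g *v x = g x" for x using g(1) by (simp add: matrix_works)
    have "transpose (matrix g) = matrix g"
      by (metis dot_lmul_matrix g(2) matrix_eq mg transpose_matrix_vector vector_eq_rdot)
    moreover have "matrix g ** matrix g = S"
      by (simp add: matrix_eq matrix_vector_mul_assoc[symmetric] mg g(4))
    ultimately show ?thesis
      using g(3) by (intro exI[of _ "matrix g"]) (simp add: positive_definite_def mg)
  qed
  then have "\<exists>!R. positive_definite R \<and> R ** R = S"
    using positive_definite_sqrt_unique by metis
  from theI'[OF this] show ?thesis by (simp add: matrix_sqrt_def)
qed

text \<open>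
  Undoing the whitening: a positive definite root has trivial kernel, so it is invertible.
\<close>

lemma matrix_sqrt_mult_inv_sqrt:
  fixes S :: "real^'k^'k"
  assumes "positive_definite S"
  shows "matrix_sqrt S *v (matrix_inv_sqrt S *v v) = v"
proof -
  let ?R = "matrix_sqrt S"
  have "x = 0" if "?R *v x = 0" for x
    using positive_definite_matrix_sqrt[OF assms] that by (force simp: positive_definite_def)
  then have "invertible ?R"
    by (simp add: invertible_left_inverse matrix_left_invertible_ker)
  then have "?R ** matrix_inv_sqrt S = mat 1"
    unfolding invertible_def matrix_inv_sqrt_def matrix_inv_def by (rule someI2_ex) simp
  then show ?thesis by (simp add: matrix_vector_mul_assoc)
qed

section \<open>Compactness of the constraint set\<close>

text \<open>
  The null sequence \<open>\<gamma>\<close> bounds the tails of all terms at once, which leaves finitely many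
  coordinates, and on these coordinatewise convergence is uniform.
\<close>

lemma tendsto_bcontfun_if_dominated:
  fixes u :: "nat \<Rightarrow> nat \<Rightarrow>\<^sub>C real"
  assumes dom: "\<And>n k. \<bar>apply_bcontfun (u n) k\<bar> \<le> \<gamma> k" "\<And>k. \<bar>apply_bcontfun l k\<bar> \<le> \<gamma> k"
    and \<gamma>: "\<gamma> \<longlonglongrightarrow> 0"
    and pw: "\<And>k. (\<lambda>n. apply_bcontfun (u n) k) \<longlonglongrightarrow> apply_bcontfun l k"
  shows "u \<longlonglongrightarrow> l"
proof (rule metric_LIMSEQ_I)
  fix e :: real assume e: "0 < e"
  have "\<forall>\<^sub>F k in sequentially. \<gamma> k < e / 4"
    using order_tendstoD(2)[OF \<gamma>, of "e / 4"] e by simp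
  then obtain N where N: "\<And>k. N \<le> k \<Longrightarrow> \<gamma> k < e / 4"
    by (auto simp: eventually_sequentially)
  have "\<forall>\<^sub>F n in sequentially. \<forall>k\<in>{..<N}. dist (apply_bcontfun (u n) k) (apply_bcontfun l k) < e / 2"
    using tendstoD[OF pw, of "e / 2"] e by (intro eventually_ball_finite) auto
  then have "\<forall>\<^sub>F n in sequentially. dist (u n) l < e"
  proof eventually_elim
    case (elim n)
    have "dist (u n) l \<le> e / 2"
    proof (rule dist_bound)
      fix k
      show "dist (apply_bcontfun (u n) k) (apply_bcontfun l k) \<le> e / 2"
      proof (cases "k < N")
        case False
        then show ?thesis
          using N[of k] dom(1)[of n k] dom(2)[of k] unfolding dist_real_def by linarith
      qed (use elim in force)
    qed
    then show ?case using e by simp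
  qed
  then show "\<exists>N. \<forall>n\<ge>N. dist (u n) l < e" by (simp add: eventually_sequentially)
qed

text \<open>
  Tychonov's theorem yields a subsequence converging in every coordinate. The product topology on
  countably many real coordinates is metrizable, so there compactness is sequential compactness.
\<close>

lemma seq_compact_E_set:
  assumes \<gamma>: "\<gamma> \<longlonglongrightarrow> 0"
  shows "seq_compact (E_set \<gamma>)"
proof (rule seq_compactI)
  fix u :: "nat \<Rightarrow> nat \<Rightarrow>\<^sub>C real"
  assume u: "\<forall>n. u n \<in> E_set \<gamma>"
  define K where "K = PiE UNIV (\<lambda>k. {- \<gamma> k..\<gamma> k})"
  have "compactin (product_topology (\<lambda>_. euclidean) UNIV) K"
    unfolding K_def by (subst compactin_PiE) auto
  then have "compact K"
    by (simp add: euclidean_product_topology)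
  then have "seq_compact K" by (rule compact_imp_seq_compact)
  moreover have uK: "apply_bcontfun (u n) \<in> K" for n
    using u by (auto simp: K_def E_set_def abs_le_iff minus_le_iff)
  ultimately obtain l r where l: "l \<in> K" and r: "strict_mono (r :: nat \<Rightarrow> nat)"
    and lim: "((\<lambda>n. apply_bcontfun (u n)) \<circ> r) \<longlonglongrightarrow> l"
    using seq_compactE[of K "\<lambda>n. apply_bcontfun (u n)"] by blast
  have l_dom: "\<bar>l k\<bar> \<le> \<gamma> k" for k using l by (auto simp: K_def abs_le_iff PiE_iff minus_le_iff)
  have l_null: "l \<longlonglongrightarrow> 0"
    by (rule Lim_null_comparison[OF _ \<gamma>]) (simp add: l_dom)
  then have "bounded (range l)" by (rule convergent_imp_bounded)
  then have "l \<in> bcontfun" by (simp add: bcontfun_def)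
  then have app: "apply_bcontfun (Bcontfun l) = l" by (rule Bcontfun_inverse)
  have pw: "(\<lambda>n. apply_bcontfun (u (r n)) k) \<longlonglongrightarrow> l k" for k
  proof -
    have "isCont (\<lambda>f :: nat \<Rightarrow> real. f k) l"
      using continuous_on_product_coordinates by (metis UNIV_I continuous_on_eq_continuous_at open_UNIV)
    from isCont_tendsto_compose[OF this lim] show ?thesis by simp
  qed
  have "(u \<circ> r) \<longlonglongrightarrow> Bcontfun l"
    by (rule tendsto_bcontfun_if_dominated[OF _ _ \<gamma>]) (use u app l_dom pw in \<open>auto simp: E_set_def\<close>)
  moreover have "Bcontfun l \<in> E_set \<gamma>"
    using l_null l_dom by (simp add: E_set_def c0_def app)
  ultimately show "\<exists>l\<in>E_set \<gamma>. \<exists>r. strict_mono r \<and> (u \<circ> r) \<longlonglongrightarrow> l" using r by blast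
qed

section \<open>Vanishing noise\<close>

text \<open>
  Since all \<open>\<eta> n\<close> have the law \<open>N\<close>, the expectation of \<open>min 1 (\<delta> n * norm (\<eta> n))\<close> is an integral
  over \<open>N\<close> and tends to \<open>0\<close> by dominated convergence; the truncation at \<open>1\<close> provides the
  dominating function. A sequence that tends to \<open>0\<close> in mean has a
  subsequence that tends to \<open>0\<close> almost everywhere.
\<close>

lemma (in prob_space) identically_distributed_scaled_AE_subseq:
  fixes \<eta> :: "nat \<Rightarrow> 'a \<Rightarrow> 'b::euclidean_space"
  assumes meas [measurable]: "\<And>n. \<eta> n \<in> borel_measurable M"
    and law: "\<And>n. distr M borel (\<eta> n) = N"
    and \<delta>: "\<And>n. 0 < \<delta> n" "\<delta> \<longlonglongrightarrow> 0"
  obtains r :: "nat \<Rightarrow> nat" where "strict_mono r"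
    "AE \<omega> in M. (\<lambda>j. \<delta> (r j) *\<^sub>R \<eta> (r j) \<omega>) \<longlonglongrightarrow> 0"
proof -
  define h where "h n v = min 1 (\<delta> n * norm v)" for n and v :: 'b
  have [measurable]: "h n \<in> borel_measurable borel" for n
    unfolding h_def by measurable
  have h_bound: "norm (h n v) \<le> 1" for n v
    using \<delta>(1)[of n] by (auto simp: h_def min_def)
  have N: "prob_space N" "sets N = sets borel"
    using prob_space_distr[OF meas[of 0]] law[of 0] by auto
  interpret N: prob_space N by (rule N(1))
  have "(\<lambda>n. \<integral>v. h n v \<partial>N) \<longlonglongrightarrow> (\<integral>v. 0 \<partial>N)"
  proof (rule integral_dominated_convergence[where w = "\<lambda>_. 1"])
    have "(\<lambda>n. h n v) \<longlonglongrightarrow> min 1 (0 * norm v)" for v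
      unfolding h_def by (intro tendsto_intros \<delta>)
    then show "AE v in N. (\<lambda>n. h n v) \<longlonglongrightarrow> 0" by simp
  qed (use h_bound in \<open>auto simp: measurable_cong_sets[OF N(2) refl]\<close>)
  moreover have "(\<integral>\<omega>. norm (h n (\<eta> n \<omega>)) \<partial>M) = (\<integral>v. h n v \<partial>N)" for n
  proof -
    have "(\<integral>v. h n v \<partial>N) = (\<integral>\<omega>. h n (\<eta> n \<omega>) \<partial>M)"
      unfolding law[of n, symmetric] by (rule integral_distr) measurable
    moreover have "norm (h n v) = h n v" for v
      using \<delta>(1)[of n] by (simp add: h_def)
    ultimately show ?thesis by simp
  qed
  ultimately have L1: "(\<lambda>n. \<integral>\<omega>. norm (h n (\<eta> n \<omega>)) \<partial>M) \<longlonglongrightarrow> 0"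
    by simp
  have int: "integrable M (\<lambda>\<omega>. h n (\<eta> n \<omega>))" for n
    by (rule integrable_const_bound[where B = 1]) (use h_bound in auto)
  obtain r :: "nat \<Rightarrow> nat" where r: "strict_mono r"
    and ae: "AE \<omega> in M. (\<lambda>j. h (r j) (\<eta> (r j) \<omega>)) \<longlonglongrightarrow> 0"
    using tendsto_L1_AE_subseq[OF int L1] by blast
  have "AE \<omega> in M. (\<lambda>j. \<delta> (r j) *\<^sub>R \<eta> (r j) \<omega>) \<longlonglongrightarrow> 0"
    using ae
  proof eventually_elim
    case (elim \<omega>)
    (* values below 1 are not truncated *)
    have "\<forall>\<^sub>F j in sequentially. h (r j) (\<eta> (r j) \<omega>) < 1"
      using order_tendstoD(2)[OF elim] by simp
    then have "\<forall>\<^sub>F j in sequentially. norm (\<delta> (r j) *\<^sub>R \<eta> (r j) \<omega>) \<le> h (r j) (\<eta> (r j) \<omega>)"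
      by eventually_elim (use \<delta>(1) in \<open>auto simp: h_def min_def less_imp_le split: if_splits\<close>)
    then show ?case using elim by (rule Lim_null_comparison)
  qed
  with r show thesis by (rule that)
qed

section \<open>Convergence of the minimizers\<close>

lemma tikhonov_minimizer_residual_bound:
  fixes F :: "(nat \<Rightarrow>\<^sub>C real) \<Rightarrow> real^'k"
  assumes \<delta>: "0 < \<delta>" and xd: "xd \<in> E_set \<gamma>" and u: "u \<in> E_set \<gamma>"
    and min: "is_arg_min (tikhonov_functional F \<gamma> S \<delta> y) (\<lambda>u. u \<in> c0) u"
  shows "norm (matrix_inv_sqrt S *v (F u - F xd)) \<le> 2 * norm (matrix_inv_sqrt S *v (y - F xd))"
proof -
  let ?L = "matrix_inv_sqrt S"
  have "xd \<in> c0" using xd by (simp add: E_set_def)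
  then have "tikhonov_functional F \<gamma> S \<delta> y u \<le> tikhonov_functional F \<gamma> S \<delta> y xd"
    using min by (auto simp: is_arg_min_def not_less)
  then have "(norm (?L *v (F u - y)))\<^sup>2 \<le> (norm (?L *v (F xd - y)))\<^sup>2"
    using \<delta> xd u by (simp add: tikhonov_functional_def iota_def divide_right_mono field_simps)
  then have "norm (?L *v (F u - y)) \<le> norm (?L *v (F xd - y))"
    by (rule power2_le_imp_le) simp
  moreover have "?L *v (F u - F xd) = ?L *v (F u - y) + ?L *v (y - F xd)"
    by (simp flip: matrix_vector_right_distrib)
  moreover have "norm (?L *v (F xd - y)) = norm (?L *v (y - F xd))"
    by (metis matrix_vector_mult_diff_distrib norm_minus_commute)
  ultimately show ?thesis
    using norm_triangle_ineq[of "?L *v (F u - y)" "?L *v (y - F xd)"] by simp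
qed


theorem theorem6p1:
  fixes F :: "(nat \<Rightarrow>\<^sub>C real) \<Rightarrow> real^'k"
    and \<gamma> \<delta> :: "nat \<Rightarrow> real"
    and S :: "real^'k^'k"
    and xd :: "nat \<Rightarrow>\<^sub>C real"
    and M :: "'w measure"
    and \<eta> y :: "nat \<Rightarrow> 'w \<Rightarrow> real^'k"
    and x :: "nat \<Rightarrow> 'w \<Rightarrow> (nat \<Rightarrow>\<^sub>C real)"
  assumes gamma: "\<And>k. \<gamma> k \<ge> 0" "\<gamma> \<longlonglongrightarrow> 0"
    and delta: "\<And>n. \<delta> n > 0" "\<delta> \<longlonglongrightarrow> 0"
    and S: "positive_definite S"
    and F: "closed_operator_on c0 F"
    and xd: "xd \<in> E_set \<gamma>"
    and M: "prob_space M"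
    and eta_indep: "prob_space.indep_vars M (\<lambda>_. borel) \<eta> UNIV"
    and eta_normal: "\<And>n. distributed M lborel (\<eta> n) (\<lambda>v. ennreal (mvnormal_density 0 S v))"
    and y: "\<And>n \<omega>. \<omega> \<in> space M \<Longrightarrow> y n \<omega> = F xd + \<delta> n *\<^sub>R \<eta> n \<omega>"
    and x_E: "\<And>n \<omega>. \<omega> \<in> space M \<Longrightarrow> x n \<omega> \<in> E_set \<gamma>"
    and x_min: "\<And>n \<omega>. \<omega> \<in> space M \<Longrightarrow>
      is_arg_min (tikhonov_functional F \<gamma> S (\<delta> n) (y n \<omega>)) (\<lambda>u. u \<in> c0) (x n \<omega>)"
  shows "AE \<omega> in M. \<exists>r xbar. strict_mono (r :: nat \<Rightarrow> nat) \<and> xbar \<in> E_set \<gamma> \<and>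
           (\<lambda>j. x (r j) \<omega>) \<longlonglongrightarrow> xbar \<and> F xbar = F xd"
proof -
  interpret prob_space M by (rule M)
  have meas: "\<eta> n \<in> borel_measurable M" for n
    using distributed_measurable[OF eta_normal[of n]] by simp
  have law: "distr M borel (\<eta> n) = density lborel (\<lambda>v. ennreal (mvnormal_density 0 S v))" for n
    using distributed_distr_eq_density[OF eta_normal[of n]] distr_cong[of M M borel lborel "\<eta> n" "\<eta> n"]
    by simp
  obtain r where r: "strict_mono r"
    and noise: "AE \<omega> in M. (\<lambda>j. \<delta> (r j) *\<^sub>R \<eta> (r j) \<omega>) \<longlonglongrightarrow> 0"
    by (rule identically_distributed_scaled_AE_subseq[OF meas law delta])
  show ?thesis
    using noise AE_space
  proof eventually_elim
    case (elim \<omega>)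
    let ?L = "matrix_inv_sqrt S" and ?R = "matrix_sqrt S"
    have whitened: "(\<lambda>j. ?L *v (F (x (r j) \<omega>) - F xd)) \<longlonglongrightarrow> 0"
    proof (rule Lim_null_comparison)
      have "norm (?L *v (F (x n \<omega>) - F xd)) \<le> 2 * norm (?L *v (\<delta> n *\<^sub>R \<eta> n \<omega>))" for n
        using tikhonov_minimizer_residual_bound[OF delta(1) xd x_E x_min, of \<omega> n] elim(2)
        by (simp add: y)
      then show "\<forall>\<^sub>F j in sequentially. norm (?L *v (F (x (r j) \<omega>) - F xd))
          \<le> 2 * norm (?L *v (\<delta> (r j) *\<^sub>R \<eta> (r j) \<omega>))" by simp
      have "(\<lambda>j. ?L *v (\<delta> (r j) *\<^sub>R \<eta> (r j) \<omega>)) \<longlonglongrightarrow> ?L *v 0"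
        by (rule bounded_linear.tendsto[OF matrix_vector_mul_bounded_linear elim(1)])
      then show "(\<lambda>j. 2 * norm (?L *v (\<delta> (r j) *\<^sub>R \<eta> (r j) \<omega>))) \<longlonglongrightarrow> 0"
        by (intro tendsto_mult_right_zero tendsto_norm_zero) simp
    qed
    have "(\<lambda>j. ?R *v (?L *v (F (x (r j) \<omega>) - F xd))) \<longlonglongrightarrow> ?R *v 0"
      by (rule bounded_linear.tendsto[OF matrix_vector_mul_bounded_linear whitened])
    then have F_lim: "(\<lambda>j. F (x (r j) \<omega>)) \<longlonglongrightarrow> F xd"
      by (simp add: matrix_sqrt_mult_inv_sqrt[OF S] LIM_zero_iff)
    obtain xbar s where xbar: "xbar \<in> E_set \<gamma>" and s: "strict_mono (s :: nat \<Rightarrow> nat)"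
      and lim: "((\<lambda>j. x (r j) \<omega>) \<circ> s) \<longlonglongrightarrow> xbar"
      using seq_compactE[OF seq_compact_E_set[OF gamma(2)], of "\<lambda>j. x (r j) \<omega>"] x_E elim(2) by blast
    have "(\<lambda>j. F (x (r (s j)) \<omega>)) \<longlonglongrightarrow> F xd"
      using LIMSEQ_subseq_LIMSEQ[OF F_lim s] by (simp add: o_def)
    moreover have "x n \<omega> \<in> c0" for n using x_E[OF elim(2)] by (simp add: E_set_def)
    ultimately have "F xbar = F xd"
      using F[unfolded closed_operator_on_def, rule_format, of "\<lambda>j. x (r (s j)) \<omega>" xbar "F xd"]
        xbar lim by (simp add: o_def E_set_def)
    then show ?case
      using strict_mono_o[OF r s] xbar lim
      by (intro exI[of _ "r \<circ> s"] exI[of _ xbar]) (simp add: o_def)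
  qed
qed

end
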